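(* Let $n_1,n_2,n_3$ be positive integers and let $\mathbf r=(r_1,\dots,r_{n_3})$ be a vector of integers with $0\le r_i\le\min\{n_1,n_2\}$. Let $$\mathcal M_{\mathbf r}=\{\mathcal X\in\mathbb R^{n_1\times n_2\times n_3}:\ \operatorname{rank}_t(\mathcal X)=\mathbf r\}$$ be the set of tensors of fixed transformed multi-rank $\mathbf r$. Then $\mathcal M_{\mathbf r}$ is an embedded submanifold of $\mathbb R^{n_1\times n_2\times n_3}$ and its dimension is $\sum_{i=1}^{n_3}\big((n_1+n_2)r_i-r_i^2\big)$.
   Context: For $\mathcal A\in\mathbb R^{n_1\times n_2\times n_3}$, $\widehat{\mathcal A}\in\mathbb R^{n_1\times n_2\times n_3}$ denotes the tensor obtained by applying the orthonormal discrete cosine transform (DCT, an $n_3\times n_3$ real orthogonal matrix) to every tube $\mathcal A(i,j,:)$. $\widehat{\mathcal A}^{(i)}=\widehat{\mathcal A}(:,:,i)$ is its $i$-th frontal slice, an $n_1\times n_2$ matrix. The transformed multi-rank of $\mathcal A$ is the vector $\operatorname{rank}_t(\mathcal A)=(r_1,\dots,r_{n_3})$ with $r_i=\operatorname{rank}(\widehat{\mathcal A}^{(i)})$. *)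

theory Defs
  imports "HOL-Analysis.Analysis"
begin

text \<open>
  \<open>C_diff_on k f S\<close> is meant for open \<open>S\<close>: \<open>f\<close> is \<open>k\<close> times continuously (Frechet)
  differentiable on \<open>S\<close>.  In finite dimension, continuity of the derivative in the operator norm
  is the same as continuity of all directional derivatives.
\<close>

primrec C_diff_on ::
  "nat \<Rightarrow> ('a::euclidean_space \<Rightarrow> 'b::euclidean_space) \<Rightarrow> 'a set \<Rightarrow> bool" where
  "C_diff_on 0 f S \<longleftrightarrow> continuous_on S f"
| "C_diff_on (Suc k) f S \<longleftrightarrow>
     (\<forall>x\<in>S. f differentiable (at x)) \<and>
     (\<forall>v. C_diff_on k (\<lambda>x. frechet_derivative f (at x) v) S)"

definition smooth_on ::
  "('a::euclidean_space \<Rightarrow> 'b::euclidean_space) \<Rightarrow> 'a set \<Rightarrow> bool" where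
  "smooth_on f S \<longleftrightarrow> (\<forall>k. C_diff_on k f S)"

definition diffeomorphism ::
  "'a::euclidean_space set \<Rightarrow> 'b::euclidean_space set \<Rightarrow> ('a \<Rightarrow> 'b) \<Rightarrow> ('b \<Rightarrow> 'a) \<Rightarrow> bool" where
  "diffeomorphism U V \<phi> \<psi> \<longleftrightarrow>
     open U \<and> open V \<and> homeomorphism U V \<phi> \<psi> \<and> smooth_on \<phi> U \<and> smooth_on \<psi> V"

text \<open>
  Smooth embedded submanifold of a Euclidean space, by slice charts: around each of its points,
  a diffeomorphism between open sets of the ambient space straightens \<open>M\<close> to a \<open>d\<close>-dimensional
  linear subspace.  Nonemptiness is required so that \<open>d\<close> is determined by \<open>M\<close>.
\<close>

definition embedded_submanifold :: "nat \<Rightarrow> 'a::euclidean_space set \<Rightarrow> bool" where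
  "embedded_submanifold d M \<longleftrightarrow>
     M \<noteq> {} \<and>
     (\<forall>x\<in>M. \<exists>U V \<phi> \<psi> (S :: 'a set).
        x \<in> U \<and> diffeomorphism U V \<phi> \<psi> \<and>
        subspace S \<and> dim S = d \<and> \<phi> ` (U \<inter> M) = V \<inter> S)"

text \<open>
  A tensor in \<open>\<real>\<^bsup>n1\<times>n2\<times>n3\<^esup>\<close> has type \<^typ>\<open>real^'n3^'n2^'n1\<close>, with entries \<open>A $ i $ j $ k\<close> and
  tubes \<open>A $ i $ j\<close>.  The transform depends on the order of the entries of a tube, so the index
  type of the third mode is linearly ordered.
\<close>

definition index_pos :: "'n::{finite,linorder} \<Rightarrow> nat" where
  "index_pos k = card {..<k}"

text \<open>
  The orthonormal type-II discrete cosine transform; rows and columns are numbered from \<open>0\<close> by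
  \<^const>\<open>index_pos\<close>.
\<close>

definition dct_matrix :: "real^'n::{finite,linorder}^'n::{finite,linorder}" where
  "dct_matrix = (\<chi> k m.
     (if index_pos k = 0 then sqrt (1 / real CARD('n)) else sqrt (2 / real CARD('n))) *
     cos (pi * (2 * real (index_pos m) + 1) * real (index_pos k) / (2 * real CARD('n))))"

definition dct_tensor ::
  "real^'n3::{finite,linorder}^'n2^'n1 \<Rightarrow> real^'n3::{finite,linorder}^'n2^'n1" where
  "dct_tensor A = (\<chi> i j. dct_matrix *v (A $ i $ j))"

definition frontal_slice :: "real^'n3^'n2^'n1 \<Rightarrow> 'n3 \<Rightarrow> real^'n2^'n1" where
  "frontal_slice A k = (\<chi> i j. A $ i $ j $ k)"

definition transformed_multirank ::
  "real^'n3::{finite,linorder}^'n2^'n1 \<Rightarrow> nat^'n3::{finite,linorder}" where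
  "transformed_multirank A = (\<chi> k. rank (frontal_slice (dct_tensor A) k))"

definition fixed_multirank_set ::
  "nat^'n3::{finite,linorder} \<Rightarrow> (real^'n3::{finite,linorder}^'n2^'n1) set" where
  "fixed_multirank_set r = {X. transformed_multirank X = r}"

end

theory Submission
  imports Defs
begin

text \<open>
  The discrete cosine transform acts on tubes by an invertible matrix, so in the transformed
  coordinates the fixed multi-rank set is a product over the frontal slices of sets of matrices
  of fixed rank \<open>r\<close>.  Given a matrix of rank \<open>r\<close>, multiply it on both sides by invertible matrices
  to turn it into a partial permutation matrix.  Nearby matrices then have an invertible
  \<open>r\<close> by \<open>r\<close> block \<open>A11\<close>, and their rank is \<open>r\<close> iff the Schur complement
  \<open>A22 - A21 A11\<^sup>-\<^sup>1 A12\<close> vanishes.  Replacing the block \<open>A22\<close> by the Schur complement is a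
  diffeomorphism of the open set where \<open>A11\<close> is invertible onto itself, and it straightens the
  set of rank \<open>r\<close> matrices to the coordinate subspace \<open>A22 = 0\<close>.
\<close>

section \<open>Smooth maps\<close>

text \<open>Since \<open>S\<close> is open, the functions agree near each of its points and so have
  the same derivatives there; the induction then passes to the directional derivatives.\<close>

lemma C_diff_on_cong:
  assumes "open S" "\<And>x. x \<in> S \<Longrightarrow> f x = g x" "C_diff_on k f S"
  shows "C_diff_on k g S"
  using assms(2,3)
proof (induction k arbitrary: f g)
  case 0
  then show ?case
    using continuous_on_cong[of S S f g] by simp
next
  case (Suc k)
  have der: "(g has_derivative frechet_derivative f (at x)) (at x)" if "x \<in> S" for x
    using has_derivative_transform_within_open[of f _ x UNIV S g] Suc.prems that \<open>open S\<close>
    by (auto simp: frechet_derivative_works)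
  have eq: "frechet_derivative f (at x) = frechet_derivative g (at x)" if "x \<in> S" for x
    using frechet_derivative_at[OF der[OF that]] .
  have "C_diff_on k (\<lambda>x. frechet_derivative g (at x) v) S" for v
    by (rule Suc.IH[of "\<lambda>x. frechet_derivative f (at x) v"]) (use eq Suc.prems in auto)
  then show ?case
    using der by (auto simp: differentiable_def)
qed

text \<open>By uniqueness of the derivative, any explicit \<open>f'\<close> can replace
  \<open>frechet_derivative\<close>. The closure properties below all enter through this
  rule.\<close>

lemma C_diff_on_SucI:
  assumes "open S" "\<And>x. x \<in> S \<Longrightarrow> (f has_derivative f' x) (at x)"
    and "\<And>v. C_diff_on k (\<lambda>x. f' x v) S"
  shows "C_diff_on (Suc k) f S"
proof -
  have "C_diff_on k (\<lambda>x. frechet_derivative f (at x) v) S" for v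
    by (rule C_diff_on_cong[OF \<open>open S\<close> _ assms(3)])
      (use frechet_derivative_at[OF assms(2)] in auto)
  then show ?thesis
    using assms(2) by (auto simp: differentiable_def)
qed

lemma C_diff_on_Suc_has_derivative:
  assumes "C_diff_on (Suc k) f S" "x \<in> S"
  shows "(f has_derivative frechet_derivative f (at x)) (at x)"
  using assms by (auto simp: frechet_derivative_works)

lemma C_diff_on_Suc_imp: "C_diff_on (Suc k) f S \<Longrightarrow> C_diff_on k f S"
proof (induction k arbitrary: f)
  case 0
  then show ?case
    by (simp add: continuous_at_imp_continuous_on differentiable_imp_continuous_within)
qed auto

lemma C_diff_on_const: "open S \<Longrightarrow> C_diff_on k (\<lambda>x. c) S"
proof (induction k arbitrary: c)
  case (Suc k)
  show ?case
    by (rule C_diff_on_SucI[where f' = "\<lambda>x v. 0"]) (use Suc in \<open>auto intro!: derivative_eq_intros\<close>)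
qed simp

lemma C_diff_on_linear_compose:
  assumes "linear L" "open S" "C_diff_on k f S"
  shows "C_diff_on k (\<lambda>x. L (f x)) S"
  using assms(3)
proof (induction k arbitrary: f)
  case 0
  then show ?case
    using continuous_on_compose2[OF linear_continuous_on[of L UNIV]] \<open>linear L\<close>
    by (simp add: linear_conv_bounded_linear)
next
  case (Suc k)
  show ?case
  proof (rule C_diff_on_SucI[OF \<open>open S\<close>])
    show "((\<lambda>x. L (f x)) has_derivative (\<lambda>v. L (frechet_derivative f (at x) v))) (at x)"
      if "x \<in> S" for x
      using bounded_linear.has_derivative[OF _ C_diff_on_Suc_has_derivative[OF Suc.prems that]]
        \<open>linear L\<close> by (simp add: linear_conv_bounded_linear)
    show "C_diff_on k (\<lambda>x. L (frechet_derivative f (at x) v)) S" for v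
      using Suc by simp
  qed
qed

lemma C_diff_on_linear:
  assumes "linear L" "open S"
  shows "C_diff_on k L S"
proof (cases k)
  case 0
  then show ?thesis
    using linear_continuous_on \<open>linear L\<close> by (simp add: linear_conv_bounded_linear)
next
  case (Suc m)
  have "C_diff_on (Suc m) L S"
    by (rule C_diff_on_SucI[where f' = "\<lambda>x. L"])
      (use assms in \<open>auto simp: linear_conv_bounded_linear C_diff_on_const
        intro: bounded_linear_imp_has_derivative\<close>)
  then show ?thesis using Suc by simp
qed

lemma C_diff_on_add:
  assumes "open S" "C_diff_on k f S" "C_diff_on k g S"
  shows "C_diff_on k (\<lambda>x. f x + g x) S"
  using assms(2,3)
proof (induction k arbitrary: f g)
  case 0
  then show ?case by (simp add: continuous_on_add)
next
  case (Suc k)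
  show ?case
  proof (rule C_diff_on_SucI[OF \<open>open S\<close>])
    show "((\<lambda>x. f x + g x) has_derivative
        (\<lambda>v. frechet_derivative f (at x) v + frechet_derivative g (at x) v)) (at x)"
      if "x \<in> S" for x
      using Suc.prems that by (intro has_derivative_add C_diff_on_Suc_has_derivative)
    show "C_diff_on k (\<lambda>x. frechet_derivative f (at x) v + frechet_derivative g (at x) v) S" for v
      using Suc by simp
  qed
qed

text \<open>Product rule: each summand of the derivative is again \<open>h\<close> applied to two
  maps of class k, so the induction hypothesis, general in \<open>f\<close> and \<open>g\<close>,
  covers both. The undifferentiated factor has to be lowered from class k + 1 to class k
  first.\<close>

lemma C_diff_on_bilinear:
  assumes "bounded_bilinear h" "open S" "C_diff_on k f S" "C_diff_on k g S"
  shows "C_diff_on k (\<lambda>x. h (f x) (g x)) S"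
  using assms(3,4)
proof (induction k arbitrary: f g)
  case 0
  then show ?case
    using bounded_bilinear.continuous_on[OF assms(1)] by simp
next
  case (Suc k)
  show ?case
  proof (rule C_diff_on_SucI[OF \<open>open S\<close>])
    show "((\<lambda>x. h (f x) (g x)) has_derivative
        (\<lambda>v. h (f x) (frechet_derivative g (at x) v) + h (frechet_derivative f (at x) v) (g x))) (at x)"
      if "x \<in> S" for x
      by (intro bounded_bilinear.FDERIV[OF assms(1)] C_diff_on_Suc_has_derivative[OF Suc.prems(1) that]
          C_diff_on_Suc_has_derivative[OF Suc.prems(2) that])
    show "C_diff_on k (\<lambda>x. h (f x) (frechet_derivative g (at x) v)
        + h (frechet_derivative f (at x) v) (g x)) S" for v
      using Suc.prems C_diff_on_Suc_imp[OF Suc.prems(1)] C_diff_on_Suc_imp[OF Suc.prems(2)]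
      by (intro C_diff_on_add[OF \<open>open S\<close>] Suc.IH) auto
  qed
qed

lemma C_diff_on_inverse:
  fixes f :: "'a::euclidean_space \<Rightarrow> real"
  assumes "open S" "\<And>x. x \<in> S \<Longrightarrow> f x \<noteq> 0" "C_diff_on k f S"
  shows "C_diff_on k (\<lambda>x. inverse (f x)) S"
  using assms(3)
proof (induction k)
  case 0
  then show ?case using assms by (simp add: continuous_on_inverse)
next
  case (Suc k)
  note mult = C_diff_on_bilinear[OF bounded_bilinear_mult \<open>open S\<close>]
  \<comment> \<open>The derivative of 1/f is -f'/f^2, a product of f' and copies of 1/f itself.
    Class k of 1/f, known by induction, therefore yields class k + 1.\<close>
  have inv: "C_diff_on k (\<lambda>x. inverse (f x)) S"
    using Suc C_diff_on_Suc_imp by blast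
  show ?case
  proof (rule C_diff_on_SucI[OF \<open>open S\<close>])
    show "((\<lambda>x. inverse (f x)) has_derivative
        (\<lambda>v. (-1) * (inverse (f x) * (frechet_derivative f (at x) v * inverse (f x))))) (at x)"
      if "x \<in> S" for x
      using Deriv.has_derivative_inverse[OF assms(2)[OF that] C_diff_on_Suc_has_derivative[OF Suc.prems that]]
      by (simp add: mult.assoc)
    show "C_diff_on k (\<lambda>x. (-1) * (inverse (f x) * (frechet_derivative f (at x) v * inverse (f x)))) S" for v
      using Suc.prems by (intro mult inv C_diff_on_const \<open>open S\<close>) auto
  qed
qed

lemma smooth_on_cong:
  "open S \<Longrightarrow> (\<And>x. x \<in> S \<Longrightarrow> f x = g x) \<Longrightarrow> smooth_on f S \<Longrightarrow> smooth_on g S"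
  unfolding smooth_on_def using C_diff_on_cong by blast

lemma smooth_on_imp_continuous_on: "smooth_on f S \<Longrightarrow> continuous_on S f"
  unfolding smooth_on_def using C_diff_on.simps(1) by blast

lemma smooth_on_const: "open S \<Longrightarrow> smooth_on (\<lambda>x. c) S"
  unfolding smooth_on_def using C_diff_on_const by blast

lemma smooth_on_linear: "linear L \<Longrightarrow> open S \<Longrightarrow> smooth_on L S"
  unfolding smooth_on_def using C_diff_on_linear by blast

lemma smooth_on_linear_compose:
  "linear L \<Longrightarrow> open S \<Longrightarrow> smooth_on f S \<Longrightarrow> smooth_on (\<lambda>x. L (f x)) S"
  unfolding smooth_on_def using C_diff_on_linear_compose by blast

lemma smooth_on_add:
  "open S \<Longrightarrow> smooth_on f S \<Longrightarrow> smooth_on g S \<Longrightarrow> smooth_on (\<lambda>x. f x + g x) S"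
  unfolding smooth_on_def using C_diff_on_add by blast

lemma smooth_on_bilinear:
  "bounded_bilinear h \<Longrightarrow> open S \<Longrightarrow> smooth_on f S \<Longrightarrow> smooth_on g S \<Longrightarrow> smooth_on (\<lambda>x. h (f x) (g x)) S"
  unfolding smooth_on_def using C_diff_on_bilinear by blast

lemma smooth_on_inverse:
  fixes f :: "'a::euclidean_space \<Rightarrow> real"
  shows "open S \<Longrightarrow> (\<And>x. x \<in> S \<Longrightarrow> f x \<noteq> 0) \<Longrightarrow> smooth_on f S \<Longrightarrow> smooth_on (\<lambda>x. inverse (f x)) S"
  unfolding smooth_on_def using C_diff_on_inverse by blast

lemma smooth_on_diff:
  assumes "open S" "smooth_on f S" "smooth_on g S"
  shows "smooth_on (\<lambda>x. f x - g x) S"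
  using smooth_on_add[OF assms(1,2) smooth_on_linear_compose[OF linear_uminus assms(1,3)]] by simp

lemma smooth_on_sum:
  assumes "open S" "\<And>i. i \<in> I \<Longrightarrow> smooth_on (f i) S"
  shows "smooth_on (\<lambda>x. \<Sum>i\<in>I. f i x) S"
  using assms(2)
  by (induction I rule: infinite_finite_induct)
    (auto intro: smooth_on_add smooth_on_const \<open>open S\<close>)

lemma smooth_on_prod:
  fixes f :: "'i \<Rightarrow> 'a::euclidean_space \<Rightarrow> real"
  assumes "open S" "\<And>i. i \<in> I \<Longrightarrow> smooth_on (f i) S"
  shows "smooth_on (\<lambda>x. \<Prod>i\<in>I. f i x) S"
  using assms(2)
  by (induction I rule: infinite_finite_induct)
    (auto intro: smooth_on_bilinear[OF bounded_bilinear_mult] smooth_on_const \<open>open S\<close>)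

lemma smooth_on_vec_nth: "open S \<Longrightarrow> smooth_on f S \<Longrightarrow> smooth_on (\<lambda>x. f x $ i) S"
  by (rule smooth_on_linear_compose[of "\<lambda>v. v $ i"]) (auto simp: linear_iff)

text \<open>A vector is the sum of its components, each placed at its index by the linear map
  \<open>axis i\<close>, so sums and linear composition suffice.\<close>

lemma smooth_on_vec_lambda:
  fixes f :: "'a::euclidean_space \<Rightarrow> 'i::finite \<Rightarrow> 'b::euclidean_space"
  assumes "open S" "\<And>i. smooth_on (\<lambda>x. f x i) S"
  shows "smooth_on (\<lambda>x. \<chi> i. f x i) S"
proof -
  have "linear (axis i :: 'b \<Rightarrow> 'b^'i)" for i
    by (auto simp: linear_iff axis_def vec_eq_iff)
  then have "smooth_on (\<lambda>x. \<Sum>i\<in>UNIV. axis i (f x i)) S"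
    using assms by (intro smooth_on_sum smooth_on_linear_compose[where L = "axis _"]) auto
  moreover have "(\<Sum>i\<in>UNIV. axis i (f x i)) = (\<chi> i. f x i)" for x
    by (simp add: vec_eq_iff axis_def)
  ultimately show ?thesis by simp
qed

lemma smooth_on_matrix_mult:
  fixes A :: "'a::euclidean_space \<Rightarrow> real^'n^'m" and B :: "'a \<Rightarrow> real^'k^'n"
  assumes "open S" "smooth_on A S" "smooth_on B S"
  shows "smooth_on (\<lambda>x. A x ** B x) S"
  unfolding matrix_matrix_mult_def
  by (intro smooth_on_vec_lambda smooth_on_sum smooth_on_bilinear[OF bounded_bilinear_mult]
      smooth_on_vec_nth assms)

lemma smooth_on_det:
  fixes A :: "'a::euclidean_space \<Rightarrow> real^'n^'n"
  assumes "open S" "smooth_on A S"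
  shows "smooth_on (\<lambda>x. det (A x)) S"
  unfolding det_def
  by (intro smooth_on_sum smooth_on_bilinear[OF bounded_bilinear_mult] smooth_on_prod
      smooth_on_vec_nth smooth_on_const assms)

section \<open>Smoothness of matrix inversion\<close>

lemma matrix_inv_right:
  assumes "invertible A"
  shows "A ** matrix_inv A = mat 1"
  using assms unfolding invertible_def matrix_inv_def by (rule someI2_ex) simp

lemma matrix_inv_left:
  assumes "invertible A"
  shows "matrix_inv A ** A = mat 1"
  using assms unfolding invertible_def matrix_inv_def by (rule someI2_ex) simp

text \<open>Column j of the inverse solves A x = e_j, so Cramer's rule gives its entries. They
  appear as a determinant times \<open>inverse (det A)\<close>, which the smoothness rules for
  products and reciprocals can handle.\<close>

lemma matrix_inv_cramer:
  fixes A :: "real^'n^'n"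
  assumes "det A \<noteq> 0"
  shows "matrix_inv A = (\<chi> i j. det (\<chi> k l. if l = i then mat 1 $ k $ j else A $ k $ l) * inverse (det A))"
proof -
  have inv: "A ** matrix_inv A = mat 1"
    using assms invertible_det_nz[of A] by (simp add: matrix_inv_right)
  have "A *v column j (matrix_inv A) = column j (mat 1)" for j
    using inv by (metis matrix_vector_mult_basis matrix_vector_mul_assoc)
  then have "column j (matrix_inv A) =
      (\<chi> i. det (\<chi> k l. if l = i then column j (mat 1) $ k else A $ k $ l) / det A)" for j
    using cramer[OF assms] by blast
  moreover have "column j (mat 1 :: real^'n^'n) $ k = mat 1 $ k $ j" for j k
    by (simp add: column_def)
  ultimately have "column j (matrix_inv A) $ i =
      det (\<chi> k l. if l = i then mat 1 $ k $ j else A $ k $ l) * inverse (det A)" for i j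
    by (simp only: vec_lambda_beta divide_inverse)
  then show ?thesis
    by (simp add: vec_eq_iff column_def)
qed

lemma smooth_on_matrix_inv:
  fixes A :: "'a::euclidean_space \<Rightarrow> real^'n^'n"
  assumes "open S" "smooth_on A S" "\<And>x. x \<in> S \<Longrightarrow> det (A x) \<noteq> 0"
  shows "smooth_on (\<lambda>x. matrix_inv (A x)) S"
proof (rule smooth_on_cong[OF \<open>open S\<close> matrix_inv_cramer[symmetric, OF assms(3)]])
  have entry: "smooth_on (\<lambda>x. if l = i then mat 1 $ k $ j else A x $ k $ l) S" for i j k l :: 'n
    by (cases "l = i") (simp_all add: smooth_on_const smooth_on_vec_nth assms)
  show "smooth_on (\<lambda>x. \<chi> i j. det (\<chi> k l. if l = i then mat 1 $ k $ j else A x $ k $ l)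
      * inverse (det (A x))) S"
    by (intro smooth_on_vec_lambda smooth_on_bilinear[OF bounded_bilinear_mult] smooth_on_det
        smooth_on_inverse entry assms)
qed

section \<open>Schur complements and rank\<close>

lemma matrix_add_rdistrib:
  fixes A B :: "'a::semiring_1^'n^'m" and C :: "'a^'k^'n"
  shows "(A + B) ** C = A ** C + B ** C"
  by (simp add: vec_eq_iff matrix_matrix_mult_def distrib_right sum.distrib)

lemma matrix_diff_ldistrib:
  fixes A :: "'a::ring_1^'n^'m" and B C :: "'a^'k^'n"
  shows "A ** (B - C) = A ** B - A ** C"
  by (simp add: vec_eq_iff matrix_matrix_mult_def right_diff_distrib sum_subtractf)

lemma matrix_diff_rdistrib:
  fixes A B :: "'a::ring_1^'n^'m" and C :: "'a^'k^'n"
  shows "(A - B) ** C = A ** C - B ** C"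
  by (simp add: vec_eq_iff matrix_matrix_mult_def left_diff_distrib sum_subtractf)

lemma matrix_mult_zero_left [simp]: "(0 :: 'a::semiring_1^'n^'m) ** A = 0"
  by (simp add: vec_eq_iff matrix_matrix_mult_def)

lemma matrix_mult_zero_right [simp]: "A ** (0 :: 'a::semiring_1^'k^'n) = 0"
  by (simp add: vec_eq_iff matrix_matrix_mult_def)

lemmas matrix_ring_simps =
  matrix_add_ldistrib matrix_add_rdistrib matrix_diff_ldistrib matrix_diff_rdistrib matrix_mul_assoc

lemma rank_invertible_mult:
  fixes P :: "real^'m^'m" and Q :: "real^'n^'n" and A :: "real^'n^'m"
  assumes "invertible P" "invertible Q"
  shows "rank (P ** A ** Q) = rank A"
proof (rule antisym)
  show "rank (P ** A ** Q) \<le> rank A"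
    using rank_mul_le_left rank_mul_le_right le_trans by blast
  have "A = matrix_inv P ** (P ** A ** Q) ** matrix_inv Q"
    using matrix_inv_left[OF assms(1)] matrix_inv_right[OF assms(2)]
    by (metis matrix_mul_assoc matrix_mul_lid matrix_mul_rid)
  then show "rank A \<le> rank (P ** A ** Q)"
    using rank_mul_le_left rank_mul_le_right le_trans by metis
qed

text \<open>
  Let \<open>E\<close> and \<open>G\<close> be generalized inverses of each other, \<open>p = E ** G\<close> and \<open>q = G ** E\<close>.  With
  respect to these projections write a matrix \<open>A\<close> in block form, with \<open>A11 = p A q\<close>.  Then
  \<open>core E G A\<close> is invertible iff \<open>A11\<close> is, \<open>core_inv E G A\<close> is then the inverse of \<open>A11\<close> padded by
  zeros, and \<open>corner E G (A - A ** core_inv E G A ** A)\<close> is the Schur complement of \<open>A11\<close>.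
\<close>

definition core :: "real^'n^'m \<Rightarrow> real^'m^'n \<Rightarrow> real^'n^'m \<Rightarrow> real^'n^'n" where
  "core E G A = G ** A ** (G ** E) + (mat 1 - G ** E)"

definition core_inv :: "real^'n^'m \<Rightarrow> real^'m^'n \<Rightarrow> real^'n^'m \<Rightarrow> real^'m^'n" where
  "core_inv E G A = matrix_inv (core E G A) ** G"

definition corner :: "real^'n^'m \<Rightarrow> real^'m^'n \<Rightarrow> real^'n^'m \<Rightarrow> real^'n^'m" where
  "corner E G B = (mat 1 - E ** G) ** B ** (mat 1 - G ** E)"

text \<open>Only the block A22 changes: the corner of A K A, where K is the padded inverse of A11,
  is A21 A11^-1 A12.\<close>

definition schur :: "real^'n^'m \<Rightarrow> real^'m^'n \<Rightarrow> real^'n^'m \<Rightarrow> real^'n^'m" where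
  "schur E G A = A - corner E G (A ** core_inv E G A ** A)"

definition unschur :: "real^'n^'m \<Rightarrow> real^'m^'n \<Rightarrow> real^'n^'m \<Rightarrow> real^'n^'m" where
  "unschur E G A = A + corner E G (A ** core_inv E G A ** A)"

locale generalized_inverse =
  fixes E :: "real^'n^'m" and G :: "real^'m^'n"
  assumes EGE: "E ** G ** E = E" and GEG: "G ** E ** G = G"
begin

text \<open>This puts the normal form \<open>E\<close> itself into the domain of the chart.\<close>

lemma core_self: "core E G E = mat 1"
  by (simp add: core_def matrix_mul_assoc GEG)

text \<open>\<open>core\<close> sees only the block A11, and \<open>G\<close> annihilates mat 1 - E
  ** G because G E G = G. Hence neither \<open>schur\<close> nor \<open>unschur\<close> affects
  invertibility of the core.\<close>

lemma core_add_corner: "core E G (A + corner E G X) = core E G A"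
proof -
  have "G ** corner E G X = 0"
    by (simp add: corner_def matrix_ring_simps GEG)
  then show ?thesis
    by (simp add: core_def matrix_add_ldistrib)
qed

lemma corner_diff: "corner E G (A - B) = corner E G A - corner E G B"
  by (simp add: corner_def matrix_diff_ldistrib matrix_diff_rdistrib)

lemma corner_corner: "corner E G (corner E G A) = corner E G A"
proof -
  have "(mat 1 - E ** G) ** (mat 1 - E ** G) = mat 1 - E ** G"
    "(mat 1 - G ** E) ** (mat 1 - G ** E) = mat 1 - G ** E"
    by (simp_all add: matrix_ring_simps EGE GEG)
  then show ?thesis
    unfolding corner_def by (metis matrix_mul_assoc)
qed

context
  fixes A :: "real^'n^'m"
  assumes inv: "invertible (core E G A)"
begin

lemma core_mult_proj: "core E G A ** (G ** E) = G ** A ** (G ** E)"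
proof -
  have "G ** A ** G ** E ** G ** E = G ** A ** G ** E"
    by (metis GEG matrix_mul_assoc)
  then show ?thesis
    by (simp add: core_def matrix_ring_simps GEG)
qed

text \<open>The core is block diagonal for q = G ** E: it acts as G A on the range of q and as the
  identity on the kernel.\<close>

lemma proj_mult_core: "(G ** E) ** core E G A = core E G A ** (G ** E)"
  unfolding core_mult_proj by (simp add: core_def matrix_ring_simps GEG)

lemma core_inv_mult_proj: "core_inv E G A ** A ** (G ** E) = G ** E"
proof -
  have "core_inv E G A ** A ** (G ** E) = matrix_inv (core E G A) ** (core E G A ** (G ** E))"
    unfolding core_mult_proj by (simp add: core_inv_def matrix_mul_assoc)
  then show ?thesis
    by (simp add: matrix_mul_assoc matrix_inv_left[OF inv])
qed

text \<open>The inverse of the core commutes with q because the core does, and q G = G.\<close>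

lemma proj_core_inv: "(G ** E) ** core_inv E G A = core_inv E G A"
proof -
  let ?M = "matrix_inv (core E G A)"
  have "(G ** E) ** ?M = ?M ** (core E G A ** (G ** E)) ** ?M"
    by (simp add: matrix_mul_assoc matrix_inv_left[OF inv])
  also have "\<dots> = ?M ** (G ** E) ** (core E G A ** ?M)"
    by (metis proj_mult_core matrix_mul_assoc)
  also have "\<dots> = ?M ** (G ** E)"
    by (simp add: matrix_inv_right[OF inv])
  finally have "(G ** E) ** ?M = ?M ** (G ** E)" .
  then show ?thesis
    unfolding core_inv_def by (metis GEG matrix_mul_assoc)
qed

lemma core_inv_proj: "core_inv E G A ** (E ** G) = core_inv E G A"
  unfolding core_inv_def by (metis GEG matrix_mul_assoc)

text \<open>Together with \<open>core_inv_mult_proj\<close> this says that the padded inverse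
  inverts the block A11 from both sides, up to the projections p and q.\<close>

lemma proj_mult_core_inv: "(E ** G) ** A ** core_inv E G A = E ** G"
proof -
  have "G ** A ** core_inv E G A = G ** A ** (G ** E) ** core_inv E G A"
    by (metis proj_core_inv matrix_mul_assoc)
  also have "\<dots> = core E G A ** core_inv E G A"
    by (metis core_mult_proj proj_core_inv matrix_mul_assoc)
  also have "\<dots> = G"
    by (simp add: core_inv_def matrix_mul_assoc matrix_inv_right[OF inv])
  finally show ?thesis
    by (metis matrix_mul_assoc)
qed

lemma core_inv_core_inv: "core_inv E G A ** A ** core_inv E G A = core_inv E G A"
  by (metis core_inv_mult_proj proj_core_inv matrix_mul_assoc)

text \<open>The padded inverse differs from \<open>G\<close> by an invertible factor, and
  \<open>E\<close> and \<open>G\<close> bound each other's rank.\<close>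

lemma rank_core_inv: "rank (core_inv E G A) = rank E"
proof -
  have "G = core E G A ** core_inv E G A"
    by (simp add: core_inv_def matrix_mul_assoc matrix_inv_right[OF inv])
  then have "rank (core_inv E G A) = rank G"
    unfolding core_inv_def by (metis antisym rank_mul_le_right)
  moreover have "rank G = rank E"
    using EGE GEG rank_mul_le_left rank_mul_le_right by (metis antisym le_trans)
  ultimately show ?thesis by simp
qed

text \<open>Write K for the padded inverse; K A K = K always holds. If also A K A = A, then A and K
  bound each other's rank. Conversely K = K (A K) gives rank (A K) \<ge> rank K = rank A, so A K has
  the same range as A; being idempotent, A K fixes that range, whence A K A = A.\<close>

lemma rank_eq_iff_core_inv: "rank A = rank E \<longleftrightarrow> A ** core_inv E G A ** A = A"
proof
  let ?K = "core_inv E G A"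
  assume "A ** ?K ** A = A"
  then have "rank A = rank ?K"
    using core_inv_core_inv rank_mul_le_left rank_mul_le_right by (metis antisym le_trans)
  then show "rank A = rank E"
    by (simp add: rank_core_inv)
next
  let ?K = "core_inv E G A"
  assume r: "rank A = rank E"
  have "rank ?K \<le> rank (A ** ?K)"
    using core_inv_core_inv rank_mul_le_right by (metis matrix_mul_assoc)
  then have "dim (range ((*v) A)) \<le> dim (range ((*v) (A ** ?K)))"
    using r by (simp add: rank_core_inv flip: rank_dim_range)
  moreover have "range ((*v) (A ** ?K)) \<subseteq> range ((*v) A)"
    by (auto simp flip: matrix_vector_mul_assoc)
  ultimately have range: "range ((*v) (A ** ?K)) = range ((*v) A)"
    by (intro subspace_dim_equal) (auto intro!: linear_subspace_image matrix_vector_mul_linear)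
  have "(A ** ?K ** A) *v v = A *v v" for v
  proof -
    obtain w where w: "A *v v = (A ** ?K) *v w"
      using range by blast
    have "(A ** ?K ** A) *v v = (A ** (?K ** A ** ?K)) *v w"
      by (metis w matrix_mul_assoc matrix_vector_mul_assoc)
    then show ?thesis
      by (simp add: w core_inv_core_inv)
  qed
  then show "A ** ?K ** A = A"
    by (simp add: matrix_eq)
qed

text \<open>The matrix Z = A - A K A satisfies p Z = 0 and Z q = 0, so it lives entirely in the
  corner block.\<close>

lemma corner_schur: "corner E G (schur E G A) = A - A ** core_inv E G A ** A"
proof -
  let ?K = "core_inv E G A"
  let ?Z = "A - A ** ?K ** A"
  have "?Z ** (G ** E) = A ** (G ** E) - A ** (?K ** A ** (G ** E))"
    by (simp add: matrix_ring_simps)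
  then have right: "?Z ** (G ** E) = 0"
    by (simp add: core_inv_mult_proj)
  have "(E ** G) ** ?Z = (E ** G) ** A - ((E ** G) ** A ** ?K) ** A"
    by (simp add: matrix_ring_simps)
  then have left: "(E ** G) ** ?Z = 0"
    by (simp add: proj_mult_core_inv)
  have "(mat 1 - E ** G) ** ?Z = ?Z"
    using left by (simp only: matrix_diff_rdistrib[of "mat 1"] matrix_mul_lid diff_zero)
  moreover have "?Z ** (mat 1 - G ** E) = ?Z"
    using right by (simp only: matrix_diff_ldistrib[of _ "mat 1"] matrix_mul_rid diff_zero)
  ultimately have "corner E G ?Z = ?Z"
    by (simp add: corner_def)
  then show ?thesis
    by (simp add: schur_def corner_diff corner_corner)
qed

text \<open>This is the straightening: in the coordinates given by \<open>schur\<close>, the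
  nonlinear rank condition is linear.\<close>

lemma rank_eq_iff_corner_schur: "rank A = rank E \<longleftrightarrow> corner E G (schur E G A) = 0"
  unfolding rank_eq_iff_core_inv corner_schur by auto

text \<open>K = q K and K = K p, so a corner matrix vanishes when multiplied by K on either side.
  The correction term A K A is thus the same before and after \<open>schur\<close> or
  \<open>unschur\<close>, which makes these maps mutually inverse.\<close>

lemma add_corner_core_inv:
  "(A + corner E G X) ** core_inv E G A ** (A + corner E G X) = A ** core_inv E G A ** A"
proof -
  have "(mat 1 - G ** E) ** core_inv E G A = 0"
    by (simp add: matrix_diff_rdistrib proj_core_inv)
  then have "corner E G X ** core_inv E G A = 0"
    by (metis corner_def matrix_mul_assoc matrix_mult_zero_right)
  moreover have "core_inv E G A ** (mat 1 - E ** G) = 0"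
    by (simp add: matrix_diff_ldistrib core_inv_proj)
  then have "core_inv E G A ** corner E G X = 0"
    by (metis corner_def matrix_mul_assoc matrix_mult_zero_left)
  then have "A ** core_inv E G A ** corner E G X = 0"
    by (metis matrix_mul_assoc matrix_mult_zero_right)
  ultimately show ?thesis
    by (simp add: matrix_add_ldistrib matrix_add_rdistrib)
qed

lemma corner_minus: "- corner E G X = corner E G (- X)"
  using corner_diff[of 0 X] by (simp add: corner_def)

lemma core_schur: "core E G (schur E G A) = core E G A"
  by (simp add: schur_def core_add_corner corner_minus flip: add_uminus_conv_diff)

lemma core_unschur: "core E G (unschur E G A) = core E G A"
  by (simp add: unschur_def core_add_corner)

lemma unschur_schur: "unschur E G (schur E G A) = A"
proof -
  have "schur E G A ** core_inv E G A ** schur E G A = A ** core_inv E G A ** A"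
    by (simp add: schur_def add_corner_core_inv corner_minus flip: add_uminus_conv_diff)
  moreover have "core_inv E G (schur E G A) = core_inv E G A"
    by (simp add: core_inv_def core_schur)
  ultimately show ?thesis
    \<comment> \<open>\<open>schur\<close> stays folded in the first call because the two facts
      above rewrite terms containing \<open>schur E G A\<close>; it is unfolded only for the final
      cancellation.\<close>
    by (simp add: unschur_def) (simp add: schur_def)
qed

lemma schur_unschur: "schur E G (unschur E G A) = A"
proof -
  have "unschur E G A ** core_inv E G A ** unschur E G A = A ** core_inv E G A ** A"
    by (simp add: unschur_def add_corner_core_inv)
  moreover have "core_inv E G (unschur E G A) = core_inv E G A"
    by (simp add: core_inv_def core_unschur)
  ultimately show ?thesis
    by (simp add: schur_def) (simp add: unschur_def)
qed

end

end

section \<open>Partial permutation matrices\<close>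

definition partial_perm :: "'n set \<Rightarrow> ('n \<Rightarrow> 'm) \<Rightarrow> real^'n^'m" where
  "partial_perm J \<sigma> = (\<chi> i j. if j \<in> J \<and> i = \<sigma> j then 1 else 0)"

definition coord_proj :: "'n set \<Rightarrow> real^'n^'n" where
  "coord_proj I = (\<chi> i j. if i = j \<and> i \<in> I then 1 else 0)"

lemma partial_perm_mult_transpose:
  assumes "inj_on \<sigma> J"
  shows "partial_perm J \<sigma> ** transpose (partial_perm J \<sigma>) = coord_proj (\<sigma> ` J)"
proof -
  have "(\<Sum>j\<in>UNIV. partial_perm J \<sigma> $ i $ j * partial_perm J \<sigma> $ i' $ j) = coord_proj (\<sigma> ` J) $ i $ i'" for i i'
  proof (cases "i = i' \<and> i \<in> \<sigma> ` J")
    case True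
    then obtain j where j: "j \<in> J" "i = \<sigma> j" by blast
    have "partial_perm J \<sigma> $ i $ k * partial_perm J \<sigma> $ i' $ k = (if k = j then 1 else 0)" for k
      using j True inj_onD[OF assms] by (auto simp: partial_perm_def)
    then show ?thesis
      using True j by (auto simp: coord_proj_def)
  next
    case False
    then have "partial_perm J \<sigma> $ i $ k * partial_perm J \<sigma> $ i' $ k = 0" for k
      by (auto simp: partial_perm_def)
    then show ?thesis
      using False by (auto simp: coord_proj_def intro!: sum.neutral)
  qed
  then show ?thesis
    by (simp add: vec_eq_iff matrix_matrix_mult_def transpose_def)
qed

lemma transpose_mult_partial_perm:
  assumes "inj_on \<sigma> J"
  shows "transpose (partial_perm J \<sigma>) ** partial_perm J \<sigma> = coord_proj J"
proof -
  have "partial_perm J \<sigma> $ i $ j * partial_perm J \<sigma> $ i $ j' =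
      (if i = \<sigma> j then coord_proj J $ j $ j' else 0)" for i j j'
    using inj_onD[OF assms] by (auto simp: partial_perm_def coord_proj_def)
  then show ?thesis
    by (simp add: vec_eq_iff matrix_matrix_mult_def transpose_def)
qed

lemma coord_proj_mult: "(coord_proj I ** B) $ i $ j = (if i \<in> I then B $ i $ j else 0)"
proof -
  have "coord_proj I $ i $ k * B $ k $ j = (if k = i then if i \<in> I then B $ i $ j else 0 else 0)" for k
    by (auto simp: coord_proj_def)
  then show ?thesis
    by (simp add: matrix_matrix_mult_def)
qed

lemma mult_coord_proj: "(B ** coord_proj J) $ i $ j = (if j \<in> J then B $ i $ j else 0)"
proof -
  have "B $ i $ k * coord_proj J $ k $ j = (if k = j then if j \<in> J then B $ i $ j else 0 else 0)" for k
    by (auto simp: coord_proj_def)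
  then show ?thesis
    by (simp add: matrix_matrix_mult_def)
qed

lemma generalized_inverse_partial_perm:
  assumes "inj_on \<sigma> J"
  shows "generalized_inverse (partial_perm J \<sigma>) (transpose (partial_perm J \<sigma>))"
proof
  show "partial_perm J \<sigma> ** transpose (partial_perm J \<sigma>) ** partial_perm J \<sigma> = partial_perm J \<sigma>"
    by (simp add: vec_eq_iff partial_perm_mult_transpose[OF assms] coord_proj_mult)
      (auto simp: partial_perm_def)
  show "transpose (partial_perm J \<sigma>) ** partial_perm J \<sigma> ** transpose (partial_perm J \<sigma>) =
      transpose (partial_perm J \<sigma>)"
    by (simp add: vec_eq_iff transpose_mult_partial_perm[OF assms] coord_proj_mult)
      (simp add: partial_perm_def transpose_def)
qed

text \<open>For a partial permutation and its transpose, p and q are coordinate projections, so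
  vanishing of the corner describes a coordinate subspace whose dimension can be counted.\<close>

lemma corner_partial_perm:
  assumes "inj_on \<sigma> J"
  shows "corner (partial_perm J \<sigma>) (transpose (partial_perm J \<sigma>)) B $ i $ j =
    (if i \<in> \<sigma> ` J \<or> j \<in> J then 0 else B $ i $ j)"
proof -
  have row: "mat 1 - coord_proj (\<sigma> ` J) = coord_proj (- \<sigma> ` J)"
    and col: "mat 1 - coord_proj J = coord_proj (- J)"
    by (auto simp: vec_eq_iff mat_def coord_proj_def)
  show ?thesis
    by (simp add: corner_def partial_perm_mult_transpose[OF assms] transpose_mult_partial_perm[OF assms]
        row col coord_proj_mult mult_coord_proj)
qed

lemma rank_partial_perm:
  assumes "inj_on \<sigma> J"
  shows "rank (partial_perm J \<sigma> :: real^'n^'m) = card J"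
proof -
  let ?E = "partial_perm J \<sigma> :: real^'n^'m"
  have "range ((*v) ?E) = {x. \<forall>i. i \<notin> \<sigma> ` J \<longrightarrow> x $ i = 0}"
  proof safe
    fix v i assume "i \<notin> \<sigma> ` J"
    then show "(?E *v v) $ i = 0"
      by (auto simp: matrix_vector_mult_def partial_perm_def intro!: sum.neutral)
  next
    fix x :: "real^'m" assume x: "\<forall>i. i \<notin> \<sigma> ` J \<longrightarrow> x $ i = 0"
    have "coord_proj (\<sigma> ` J) *v x = x"
    proof -
      have "coord_proj (\<sigma> ` J) $ i $ k * x $ k = (if k = i then x $ i else 0)" for i k
        using x by (auto simp: coord_proj_def)
      then show ?thesis
        by (simp add: vec_eq_iff matrix_vector_mult_def)
    qed
    then have "x = ?E *v (transpose ?E *v x)"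
      by (metis matrix_vector_mul_assoc partial_perm_mult_transpose[OF assms])
    then show "x \<in> range ((*v) ?E)" by blast
  qed
  then have "rank ?E = card (\<sigma> ` J)"
    using dim_substandard_cart[of "\<sigma> ` J", where 'a = real] by (simp add: rank_dim_range dim_vec_eq)
  then show ?thesis
    by (simp add: card_image assms)
qed

section \<open>Normal form of a matrix of given rank\<close>

lemma invertible_of_basis:
  fixes h :: "'n::finite \<Rightarrow> real^'n"
  assumes "inj h" "independent (range h)"
  shows "invertible (\<chi> i j. h j $ i)"
proof -
  let ?A = "(\<chi> i j. h j $ i) :: real^'n^'n"
  have col: "column j ?A = h j" for j
    by (simp add: column_def vec_eq_iff)
  have "columns ?A = range h"
    by (auto simp: columns_def col)
  then have "rank ?A = CARD('n)"
    using assms by (simp add: column_rank_def dim_eq_card_independent card_image)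
  then show ?thesis
    using full_rank_injective matrix_left_invertible_injective invertible_left_inverse by metis
qed

lemma bij_betw_extend:
  fixes A :: "'a set" and B :: "'b set"
  assumes "finite A" "card A = card B" "A' \<subseteq> A" "B' \<subseteq> B" "bij_betw f A' B'" "finite B"
  obtains g where "bij_betw g A B" "\<And>x. x \<in> A' \<Longrightarrow> g x = f x"
proof -
  have "finite A'" "finite B'"
    using assms finite_subset by blast+
  then have "card (A - A') = card (B - B')"
    using assms by (simp add: card_Diff_subset bij_betw_same_card)
  then obtain f' where f': "bij_betw f' (A - A') (B - B')"
    using assms finite_same_card_bij by blast
  have "bij_betw (\<lambda>x. if x \<in> A' then f x else f' x) (A' \<union> (A - A')) (B' \<union> (B - B'))"
    using assms(5) f' by (intro bij_betw_disjoint_Un) auto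
  moreover have "A' \<union> (A - A') = A" "B' \<union> (B - B') = B"
    using assms(3,4) by blast+
  ultimately have "bij_betw (\<lambda>x. if x \<in> A' then f x else f' x) A B"
    by simp
  then show ?thesis
    by (rule that) simp
qed

text \<open>The columns of Q are a basis h of the domain in which \<open>J\<close> indexes a
  complement of the kernel and the other indices a basis of the kernel. The columns of R are a basis
  g of the codomain with g (\<sigma> j) = A h(j) for j in \<open>J\<close>. Then A Q = R E for the
  partial permutation E, and P is the inverse of R.\<close>

lemma rank_normal_form:
  fixes A :: "real^'n^'m"
  assumes "inj_on \<sigma> J" "rank A = card J"
  obtains P :: "real^'m^'m" and Q :: "real^'n^'n"
  where "invertible P" "invertible Q" "P ** A ** Q = partial_perm J \<sigma>"
proof -
  let ?f = "(*v) A"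
  have lin: "linear ?f"
    by (rule matrix_vector_mul_linear)
  define N where "N = {x. ?f x = 0}"
  have subN: "subspace N"
    unfolding N_def by (rule linear_subspace_kernel[OF lin])
  obtain BN where BN: "BN \<subseteq> N" "independent BN" "N \<subseteq> span BN"
    by (rule maximal_independent_subset)
  obtain B where B: "BN \<subseteq> B" "independent B" "UNIV \<subseteq> span B"
    by (rule maximal_independent_subset_extend[OF subset_UNIV BN(2)])
  define C where "C = B - BN"
  have finB: "finite B"
    using B(2) by (rule independent_imp_finite)
  then have fin: "finite BN" "finite C"
    using B(1) finite_subset by (auto simp: C_def)
  have spanB: "span B = UNIV"
    using B(3) by blast
  then have cardB: "card B = CARD('n)"
    using dim_eq_card_independent[OF B(2)] dim_span[of B] by (simp add: dim_UNIV)
  have N: "span BN = N"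
    using BN subN by (simp add: span_subspace)
  have "B = BN \<union> C"
    using B by (auto simp: C_def)
  then have sum: "{x + y |x y. x \<in> N \<and> y \<in> span C} = UNIV"
    using span_Un[of BN C] spanB N by simp
  \<comment> \<open>Dimension count: \<open>N\<close> and \<open>span C\<close> together span the
    space, and their dimensions add up to that of the whole space.\<close>
  have "N \<inter> span C = {0}"
  proof -
    have "dim N = card BN"
      using dim_span_eq_card_independent[OF BN(2)] N by simp
    moreover have "dim (span C) = card C"
      using B independent_mono[of B C] by (simp add: C_def dim_eq_card_independent)
    moreover have "card B = card BN + card C"
      using fin finB B(1) by (simp add: C_def card_Diff_subset card_mono)
    ultimately have "dim (N \<inter> span C) = 0"
      using dim_sums_Int[OF subN subspace_span[of C]] cardB sum by (simp add: conj_commute)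
    then show ?thesis
      using subN subspace_0 by (auto simp: dim_eq_0)
  qed
  then have inj: "inj_on ?f (span C)"
    using linear_injective_on_subspace_0[OF lin subspace_span] by (auto simp: N_def)
  have ind: "independent (?f ` C)"
    using B independent_mono[of B C] linear_independent_injective_image[OF lin _ inj] by (simp add: C_def)
  have "span (?f ` C) = range ?f"
  proof -
    have "?f v \<in> ?f ` span C" for v
    proof -
      obtain x y where "x \<in> N" "y \<in> span C" "v = x + y"
        using sum by blast
      then show ?thesis
        by (simp add: N_def matrix_vector_right_distrib)
    qed
    then show ?thesis
      by (auto simp: linear_span_image[OF lin])
  qed
  then have "card (?f ` C) = card J"
    using ind dim_eq_card_independent[OF ind] dim_span[of "?f ` C"] assms(2) by (simp add: rank_dim_range)
  \<comment> \<open>\<open>A\<close> is injective on \<open>span C\<close> and maps it onto its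
    range, so \<open>C\<close> has as many elements as the rank of \<open>A\<close>.\<close>
  then have cardC: "card C = card J"
    using card_image[of ?f C] inj inj_on_subset span_superset by metis
  obtain h0 where "bij_betw h0 J C"
    using finite_same_card_bij[of J C] cardC fin by auto
  then obtain h where h: "bij_betw h UNIV B" and hJ: "\<And>j. j \<in> J \<Longrightarrow> h j = h0 j"
    using bij_betw_extend[of UNIV B J C h0] cardB finB by (auto simp: C_def)
  have hC: "h j \<in> C" if "j \<in> J" for j
    using \<open>bij_betw h0 J C\<close> hJ that by (auto simp: bij_betw_def)
  \<comment> \<open>All of \<open>C\<close> is already taken by indices in \<open>J\<close>, so
    injectivity of \<open>h\<close> forces \<open>h j\<close> into the kernel basis
    \<open>BN\<close>.\<close>
  have hN: "?f (h j) = 0" if "j \<notin> J" for j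
  proof -
    have "h j \<notin> C"
    proof
      assume "h j \<in> C"
      then obtain i where "i \<in> J" "h i = h j"
        using \<open>bij_betw h0 J C\<close> hJ by (auto simp: bij_betw_def)
      then show False
        using h that by (auto simp: bij_betw_def inj_on_def)
    qed
    then have "h j \<in> BN"
      using h by (auto simp: bij_betw_def C_def)
    then show ?thesis
      using BN by (auto simp: N_def)
  qed
  obtain D where D: "?f ` C \<subseteq> D" "independent D" "UNIV \<subseteq> span D"
    by (rule maximal_independent_subset_extend[OF subset_UNIV ind])
  then have "finite D"
    using independent_imp_finite by blast
  have "span D = UNIV"
    using D(3) by blast
  then have cardD: "card D = CARD('m)"
    using dim_eq_card_independent[OF D(2)] dim_span[of D] by (simp add: dim_UNIV)
  have "bij_betw (\<lambda>i. ?f (h (the_inv_into J \<sigma> i))) (\<sigma> ` J) (?f ` C)"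
  proof -
    have "bij_betw (the_inv_into J \<sigma>) (\<sigma> ` J) J"
      using assms(1) by (simp add: bij_betw_the_inv_into bij_betw_imageI)
    moreover have "bij_betw h J C"
      using \<open>bij_betw h0 J C\<close> hJ by (simp cong: bij_betw_cong)
    moreover have "bij_betw ?f C (?f ` C)"
      using inj inj_on_subset span_superset by (metis bij_betw_imageI)
    ultimately have "bij_betw (?f \<circ> (h \<circ> the_inv_into J \<sigma>)) (\<sigma> ` J) (?f ` C)"
      by (intro bij_betw_trans)
    then show ?thesis by (simp add: o_def)
  qed
  then obtain g where g: "bij_betw g UNIV D"
    and gJ: "\<And>i. i \<in> \<sigma> ` J \<Longrightarrow> g i = ?f (h (the_inv_into J \<sigma> i))"
    using bij_betw_extend[of UNIV D "\<sigma> ` J" "?f ` C"] cardD \<open>finite D\<close> D(1) by auto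
  let ?Q = "(\<chi> i j. h j $ i) :: real^'n^'n"
  let ?R = "(\<chi> i j. g j $ i) :: real^'m^'m"
  have Q: "invertible ?Q"
    using h B(2) by (intro invertible_of_basis) (auto simp: bij_betw_def)
  have R: "invertible ?R"
    using g D(2) by (intro invertible_of_basis) (auto simp: bij_betw_def)
  \<comment> \<open>Compare column j: on the left it is A h(j), on the right g (\<sigma> j) if j is
    in \<open>J\<close> and zero otherwise.\<close>
  have "(A ** ?Q) $ i $ j = (?R ** partial_perm J \<sigma>) $ i $ j" for i j
  proof -
    have "(A ** ?Q) $ i $ j = ?f (h j) $ i"
      by (simp add: matrix_matrix_mult_def matrix_vector_mult_def)
    also have "\<dots> = (if j \<in> J then g (\<sigma> j) $ i else 0)"
      using gJ[of "\<sigma> j"] hN[of j] the_inv_into_f_f[OF assms(1), of j] by auto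
    also have "\<dots> = (?R ** partial_perm J \<sigma>) $ i $ j"
      by (simp add: matrix_matrix_mult_def partial_perm_def if_distrib[of "\<lambda>x. _ * x"] cong: if_cong)
    finally show ?thesis .
  qed
  then have "A ** ?Q = ?R ** partial_perm J \<sigma>"
    by (simp add: vec_eq_iff)
  then have "matrix_inv ?R ** A ** ?Q = partial_perm J \<sigma>"
    by (metis R matrix_inv_left matrix_mul_assoc matrix_mul_lid)
  moreover have "invertible (matrix_inv ?R)"
    using R matrix_inv_left matrix_inv_right invertible_def by blast
  ultimately show ?thesis
    using Q that by blast
qed

section \<open>Invertibility of the discrete cosine transform\<close>

text \<open>\<open>index_pos\<close> is strictly increasing and bounded by the cardinality; this
  turns sums over the index type into sums over m < n.\<close>

lemma bij_betw_index_pos: "bij_betw (index_pos :: 'n::{finite,linorder} \<Rightarrow> nat) UNIV {..<CARD('n)}"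
proof -
  have less: "index_pos i < index_pos j" if "i < j" for i j :: 'n
    unfolding index_pos_def using that by (intro psubset_card_mono) auto
  have "inj (index_pos :: 'n \<Rightarrow> nat)"
    using less by (metis injI less_irrefl neqE)
  moreover have "index_pos i < CARD('n)" for i :: 'n
    unfolding index_pos_def by (intro psubset_card_mono) auto
  then have "range (index_pos :: 'n \<Rightarrow> nat) \<subseteq> {..<CARD('n)}"
    by auto
  ultimately show ?thesis
    by (simp add: bij_betw_def card_image card_subset_eq)
qed

text \<open>The sum telescopes: 2 sin \<theta> cos ((2m+1) \<theta>) = sin ((2m+2) \<theta>) - sin
  (2m \<theta>).\<close>

lemma sum_cos_odd_multiples:
  fixes \<theta> :: real
  shows "2 * sin \<theta> * (\<Sum>m<n. cos ((2 * real m + 1) * \<theta>)) = sin (2 * real n * \<theta>)"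
proof (induction n)
  case (Suc n)
  have "2 * sin \<theta> * cos ((2 * real n + 1) * \<theta>)
      = sin ((2 * real n + 1) * \<theta> + \<theta>) - sin ((2 * real n + 1) * \<theta> - \<theta>)"
    by (simp add: sin_add sin_diff)
  also have "(2 * real n + 1) * \<theta> + \<theta> = 2 * real (Suc n) * \<theta>"
    by (simp add: algebra_simps)
  also have "(2 * real n + 1) * \<theta> - \<theta> = 2 * real n * \<theta>"
    by (simp add: algebra_simps)
  finally show ?case
    using Suc by (simp add: distrib_left)
qed simp

lemma sum_cos_odd_multiples_eq_0:
  assumes "0 < j" "j < 2 * int n"
  shows "(\<Sum>m<n. cos (pi * (2 * real m + 1) * real_of_int j / (2 * real n))) = 0"
proof -
  \<comment> \<open>This angle lies strictly between 0 and pi, so its sine is nonzero, while 2 n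
    \<theta> is a multiple of pi, so the telescoped sum vanishes.\<close>
  define \<theta> where "\<theta> = pi * real_of_int j / (2 * real n)"
  have "0 < \<theta>" "\<theta> < pi"
    using assms by (auto simp: \<theta>_def field_simps)
  then have "sin \<theta> \<noteq> 0"
    using sin_gt_zero by force
  moreover have "2 * real n * \<theta> = real_of_int j * pi"
    using assms by (auto simp: \<theta>_def)
  then have "sin (2 * real n * \<theta>) = 0"
    by (simp add: sin_zero_iff_int2) 
  ultimately have "(\<Sum>m<n. cos ((2 * real m + 1) * \<theta>)) = 0"
    using sum_cos_odd_multiples[of \<theta> n] by simp
  then show ?thesis
    by (simp add: \<theta>_def mult.assoc mult.left_commute)
qed

text \<open>The product of two cosines splits into frequencies k + l and k - l, whose sums over m
  vanish unless the frequency is 0. On the diagonal the sum is n for k = 0 and n/2 otherwise, which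
  is what the two normalizing factors compensate.\<close>

lemma dct_rows_orthonormal:
  assumes "k < n" "l < n"
  shows "(\<Sum>m<n.
      ((if k = 0 then sqrt (1 / real n) else sqrt (2 / real n)) * cos (pi * (2 * real m + 1) * real k / (2 * real n))) *
      ((if l = 0 then sqrt (1 / real n) else sqrt (2 / real n)) * cos (pi * (2 * real m + 1) * real l / (2 * real n))))
    = (if k = l then 1 else 0)"
proof -
  define a where "a j = (if j = 0 then sqrt (1 / real n) else sqrt (2 / real n))" for j :: nat
  \<comment> \<open>Frequencies are integers because k - l may be negative; evenness of the cosine
    reduces to the positive case.\<close>
  define c where "c m j = cos (pi * (2 * real m + 1) * real_of_int j / (2 * real n))" for m :: nat and j :: int
  have prod: "c m (int k) * c m (int l) = (c m (int k + int l) + c m (int k - int l)) / 2" for m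
    by (simp add: c_def cos_times_cos algebra_simps add_divide_distrib diff_divide_distrib)
  have c_abs: "c m \<bar>j\<bar> = c m j" for m j
    by (auto simp: c_def abs_if)
  have c0: "(\<Sum>m<n. c m j) = 0" if "j \<noteq> 0" "\<bar>j\<bar> < 2 * int n" for j
    using sum_cos_odd_multiples_eq_0[of "\<bar>j\<bar>" n] that c_abs[of _ j] by (simp add: c_def)
  have c_0: "c m 0 = 1" for m
    by (simp add: c_def)
  have sum: "(\<Sum>m<n. c m (int k) * c m (int l)) =
      ((\<Sum>m<n. c m (int k + int l)) + (\<Sum>m<n. c m (int k - int l))) / 2"
    by (simp add: prod sum.distrib sum_divide_distrib add_divide_distrib)
  have "a k * a l * (\<Sum>m<n. c m (int k) * c m (int l)) = (if k = l then 1 else 0)"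
  proof (cases "k = l")
    case True
    show ?thesis
    proof (cases "k = 0")
      case True
      then show ?thesis using \<open>k = l\<close> assms by (simp add: a_def c_def)
    next
      case False
      then have "(\<Sum>m<n. c m (int k) * c m (int l)) = real n / 2"
        unfolding sum using \<open>k = l\<close> assms c0[of "int k + int l"] c_0 by simp
      then show ?thesis using \<open>k = l\<close> False assms by (simp add: a_def)
    qed
  next
    case False
    then have "(\<Sum>m<n. c m (int k) * c m (int l)) = 0"
      unfolding sum using c0[of "int k + int l"] c0[of "int k - int l"] assms by simp
    then show ?thesis using False by simp
  qed
  then show ?thesis
    by (simp add: a_def c_def sum_distrib_left mult_ac)
qed

lemma invertible_dct_matrix: "invertible (dct_matrix :: real^'n::{finite,linorder}^'n::{finite,linorder})"
proof -
  define D :: "real^'n::{finite,linorder}^'n::{finite,linorder}" where "D = dct_matrix"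
  have "(D ** transpose D) $ k $ l = mat 1 $ k $ l" for k l
  proof -
    have pos: "index_pos j < CARD('n)" for j :: 'n
      using bij_betw_index_pos by (auto simp: bij_betw_def)
    have eq: "index_pos k = index_pos l \<longleftrightarrow> k = l"
      using bij_betw_index_pos by (auto simp: bij_betw_def inj_on_def)
    show ?thesis
      using dct_rows_orthonormal[OF pos pos, of k l]
      unfolding sum.reindex_bij_betw[OF bij_betw_index_pos, symmetric]
      by (simp add: matrix_matrix_mult_def transpose_def D_def dct_matrix_def mat_def eq)
  qed
  then have "D ** transpose D = mat 1"
    by (simp add: vec_eq_iff)
  then show ?thesis
    unfolding D_def invertible_right_inverse by blast
qed

section \<open>Tensors with given slices\<close>

lemma smooth_on_corner_term:
  fixes A :: "'a::euclidean_space \<Rightarrow> real^'n^'m"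
  assumes "open S" "smooth_on A S" "\<And>x. x \<in> S \<Longrightarrow> invertible (core E G (A x))"
  shows "smooth_on (\<lambda>x. corner E G (A x ** core_inv E G (A x) ** A x)) S"
proof -
  have core: "smooth_on (\<lambda>x. core E G (A x)) S"
    unfolding core_def
    by (intro smooth_on_add smooth_on_matrix_mult smooth_on_const assms)
  have "smooth_on (\<lambda>x. core_inv E G (A x)) S"
    unfolding core_inv_def
    by (intro smooth_on_matrix_mult smooth_on_matrix_inv core smooth_on_const)
      (use assms in \<open>auto simp: invertible_det_nz\<close>)
  then show ?thesis
    unfolding corner_def by (intro smooth_on_matrix_mult smooth_on_const assms)
qed

lemma smooth_on_schur:
  fixes A :: "'a::euclidean_space \<Rightarrow> real^'n^'m"
  assumes "open S" "smooth_on A S" "\<And>x. x \<in> S \<Longrightarrow> invertible (core E G (A x))"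
  shows "smooth_on (\<lambda>x. schur E G (A x)) S"
  unfolding schur_def by (intro smooth_on_diff smooth_on_corner_term assms)

lemma smooth_on_unschur:
  fixes A :: "'a::euclidean_space \<Rightarrow> real^'n^'m"
  assumes "open S" "smooth_on A S" "\<And>x. x \<in> S \<Longrightarrow> invertible (core E G (A x))"
  shows "smooth_on (\<lambda>x. unschur E G (A x)) S"
  unfolding unschur_def by (intro smooth_on_add smooth_on_corner_term assms)

lemma invertible_mat_1: "invertible (mat 1 :: 'a::semiring_1^'n^'n)"
  unfolding invertible_def by (rule exI[of _ "mat 1"]) simp

definition of_slices :: "('n3 \<Rightarrow> real^'n2^'n1) \<Rightarrow> real^'n3^'n2^'n1" where
  "of_slices Y = (\<chi> i j k. Y k $ i $ j)"

lemma frontal_slice_of_slices [simp]: "frontal_slice (of_slices Y) k = Y k"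
  by (simp add: frontal_slice_def of_slices_def vec_eq_iff)

lemma of_slices_frontal_slice [simp]: "of_slices (frontal_slice X) = X"
  by (simp add: frontal_slice_def of_slices_def vec_eq_iff)

lemma frontal_slice_eqI: "(\<And>k. frontal_slice X k = frontal_slice Y k) \<Longrightarrow> X = Y"
  by (metis of_slices_frontal_slice ext)

lemma frontal_slice_add: "frontal_slice (X + Y) k = frontal_slice X k + frontal_slice Y k"
  by (simp add: frontal_slice_def vec_eq_iff)

lemma frontal_slice_scaleR: "frontal_slice (c *\<^sub>R X) k = c *\<^sub>R frontal_slice X k"
  by (simp add: frontal_slice_def vec_eq_iff)

lemma linear_frontal_slice: "linear (\<lambda>X. frontal_slice X k)"
  by (simp add: linear_iff frontal_slice_add frontal_slice_scaleR)

lemma smooth_on_of_slices: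
  fixes f :: "'a::euclidean_space \<Rightarrow> 'n3::finite \<Rightarrow> real^'n2^'n1"
  assumes "open S" "\<And>k. smooth_on (\<lambda>x. f x k) S"
  shows "smooth_on (\<lambda>x. of_slices (f x)) S"
  unfolding of_slices_def by (intro smooth_on_vec_lambda smooth_on_vec_nth assms)

section \<open>Dimension of the model subspace\<close>

lemma dim_coordinate_tensors:
  fixes D :: "('n1::finite \<times> 'n2::finite \<times> 'n3::finite) set"
  shows "dim {Y :: real^'n3^'n2^'n1. \<forall>i j k. (i, j, k) \<notin> D \<longrightarrow> Y $ i $ j $ k = 0} = card D"
proof -
  \<comment> \<open>The standard basis indexed by triples, which translates vanishing of entries
    into the inner product conditions of \<open>dim_substandard\<close>.\<close>
  define e :: "'n1 \<times> 'n2 \<times> 'n3 \<Rightarrow> real^'n3^'n2^'n1"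
    where "e = (\<lambda>(i, j, k). axis i (axis j (axis k 1)))"
  have e_inner: "Y \<bullet> e (i, j, k) = Y $ i $ j $ k" for Y i j k
    by (simp add: e_def inner_axis)
  have "inj e"
    by (auto simp: inj_on_def e_def axis_eq_axis)
  have "Basis = (\<Union>i j k. {e (i, j, k)})"
    by (simp add: Basis_vec_def e_def)
  also have "\<dots> = range e"
    by auto
  finally have basis: "Basis = range e" .
  have "{Y. \<forall>i j k. (i, j, k) \<notin> D \<longrightarrow> Y $ i $ j $ k = 0} =
      {Y. \<forall>b\<in>Basis. b \<notin> e ` D \<longrightarrow> Y \<bullet> b = 0}"
    using \<open>inj e\<close> by (auto simp: basis e_inner inj_image_mem_iff)
  moreover have "e ` D \<subseteq> Basis"
    unfolding basis by blast
  ultimately show ?thesis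
    using inj_on_subset[OF \<open>inj e\<close> subset_UNIV] by (simp add: dim_substandard card_image)
qed

lemma card_cross:
  fixes I :: "'a::finite set" and J :: "'b::finite set"
  assumes "card I = r" "card J = r"
  shows "card {(i, j). i \<in> I \<or> j \<in> J} = (CARD('a) + CARD('b)) * r - r\<^sup>2"
proof -
  have "{(i, j). i \<in> I \<or> j \<in> J} = UNIV - (- I) \<times> (- J)"
    by auto
  then have "card {(i, j). i \<in> I \<or> j \<in> J} = CARD('a) * CARD('b) - (CARD('a) - r) * (CARD('b) - r)"
    using assms by (simp add: card_Diff_subset card_cartesian_product Compl_eq_Diff_UNIV)
  also have "\<dots> = (CARD('a) + CARD('b)) * r - r\<^sup>2"
  proof -
    \<comment> \<open>As r is at most both cardinalities, writing them as r + a and r + b makes the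
      natural number subtractions exact.\<close>
    obtain a b where "CARD('a) = r + a" "CARD('b) = r + b"
      using card_mono[of UNIV I] card_mono[of UNIV J] assms by (metis finite le_Suc_ex subset_UNIV)
    then show ?thesis
      by (simp add: algebra_simps power2_eq_square)
  qed
  finally show ?thesis .
qed

lemma card_cross_slices:
  fixes I :: "'n3::finite \<Rightarrow> 'n1::finite set" and J :: "'n3 \<Rightarrow> 'n2::finite set"
  assumes "\<And>k. card (I k) = r k" "\<And>k. card (J k) = r k"
  shows "card {(i, j, k). i \<in> I k \<or> j \<in> J k} = (\<Sum>k\<in>UNIV. (CARD('n1) + CARD('n2)) * r k - (r k)\<^sup>2)"
proof -
  \<comment> \<open>Moving the slice index to the front makes the set a dependent sum over slices,
    so its cardinality is a sum over k.\<close>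
  have "bij_betw (\<lambda>(k, i, j). (i, j, k)) (SIGMA k:UNIV. {(i, j). i \<in> I k \<or> j \<in> J k})
      {(i, j, k). i \<in> I k \<or> j \<in> J k}"
    by (rule bij_betwI[where g = "\<lambda>(i, j, k). (k, i, j)"]) auto
  then have "card {(i, j, k). i \<in> I k \<or> j \<in> J k} =
      card (SIGMA k:UNIV. {(i, j). i \<in> I k \<or> j \<in> J k})"
    by (simp add: bij_betw_same_card)
  also have "\<dots> = (\<Sum>k\<in>UNIV. card {(i, j). i \<in> I k \<or> j \<in> J k})"
    by (subst card_SigmaI) auto
  finally show ?thesis
    by (simp add: card_cross[OF assms])
qed

section \<open>Transformed slices as linear coordinates\<close>

lemma linear_dct_slice:
  fixes P :: "real^'n1^'n1" and Q :: "real^'n2^'n2" and k :: "'n3::{finite,linorder}"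
  shows "linear (\<lambda>X. P ** frontal_slice (dct_tensor X) k ** Q)"
proof -
  have "dct_tensor (X + Y) = dct_tensor X + dct_tensor Y" "dct_tensor (c *\<^sub>R X) = c *\<^sub>R dct_tensor X"
    for X Y :: "real^'n3::{finite,linorder}^'n2^'n1" and c
    by (simp_all add: dct_tensor_def vec_eq_iff matrix_vector_right_distrib matrix_vector_mult_scaleR)
  moreover have "P ** (c *\<^sub>R A) ** Q = c *\<^sub>R (P ** A ** Q)" for A :: "real^'n2^'n1" and c
    by (simp add: matrix_scalar_ac scalar_matrix_assoc flip: matrix_mul_assoc scalar_mult_eq_scaleR)
  ultimately show ?thesis
    by (simp add: linear_iff frontal_slice_add frontal_slice_scaleR matrix_add_ldistrib
        matrix_add_rdistrib)
qed

lemma inj_dct_tensor: "inj (dct_tensor :: real^'n3::{finite,linorder}^'n2^'n1 \<Rightarrow> _)"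
proof (rule injI)
  fix X Y :: "real^'n3::{finite,linorder}^'n2^'n1"
  assume eq: "dct_tensor X = dct_tensor Y"
  have "dct_matrix *v (X $ i $ j) = dct_matrix *v (Y $ i $ j)" for i j
    using eq by (simp add: dct_tensor_def vec_eq_iff)
  then have "X $ i $ j = Y $ i $ j" for i j
    using inj_matrix_vector_mult[OF invertible_dct_matrix] by (auto dest: injD)
  then show "X = Y"
    by (simp add: vec_eq_iff)
qed

text \<open>This is the linear change of coordinates that brings the slices of a given tensor to
  normal form. It is injective because the transform and all \<open>P k\<close>, \<open>Q k\<close>
  are, and an injective linear endomorphism in finite dimension has a linear inverse.\<close>

lemma dct_slices_isomorphism:
  fixes P :: "'n3::{finite,linorder} \<Rightarrow> real^'n1^'n1" and Q :: "'n3 \<Rightarrow> real^'n2^'n2"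
  assumes "\<And>k. invertible (P k)" "\<And>k. invertible (Q k)"
  obtains L L' :: "real^'n3::{finite,linorder}^'n2^'n1 \<Rightarrow> real^'n3::{finite,linorder}^'n2^'n1"
  where "linear L" "linear L'" "\<And>X. L' (L X) = X" "\<And>X. L (L' X) = X"
    "\<And>X k. frontal_slice (L X) k = P k ** frontal_slice (dct_tensor X) k ** Q k"
proof -
  define L where "L X = of_slices (\<lambda>k. P k ** frontal_slice (dct_tensor X) k ** Q k)"
    for X :: "real^'n3::{finite,linorder}^'n2^'n1"
  have slice: "frontal_slice (L X) k = P k ** frontal_slice (dct_tensor X) k ** Q k" for X k
    by (simp add: L_def)
  have "linear L"
    using linear_add[OF linear_dct_slice] linear_scale[OF linear_dct_slice]
    by (intro linearI frontal_slice_eqI) (simp_all add: slice frontal_slice_add frontal_slice_scaleR)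
  moreover have "inj L"
  proof (rule injI)
    fix X Y assume "L X = L Y"
    then have eq: "P k ** frontal_slice (dct_tensor X) k ** Q k = P k ** frontal_slice (dct_tensor Y) k ** Q k" for k
      by (metis slice)
    have "matrix_inv (P k) ** (P k ** A ** Q k) ** matrix_inv (Q k) = A" for A k
      by (metis assms matrix_inv_left matrix_inv_right matrix_mul_assoc matrix_mul_lid matrix_mul_rid)
    then have "frontal_slice (dct_tensor X) k = frontal_slice (dct_tensor Y) k" for k
      using eq by metis
    then show "X = Y"
      using inj_dct_tensor by (metis frontal_slice_eqI injD)
  qed
  ultimately obtain L' where "linear L'" "\<And>X. L' (L X) = X" "\<And>X. L (L' X) = X"
    using linear_injective_isomorphism by blast
  then show ?thesis
    using that slice \<open>linear L\<close> by blast
qed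

section \<open>The slice charts\<close>

definition core_domain ::
  "('n3::finite \<Rightarrow> real^'n2^'n1) \<Rightarrow> ('n3 \<Rightarrow> real^'n1^'n2) \<Rightarrow> (real^'n3^'n2^'n1) set" where
  "core_domain E G = {Y. \<forall>k. invertible (core (E k) (G k) (frontal_slice Y k))}"

definition schur_chart ::
  "('n3::finite \<Rightarrow> real^'n2^'n1) \<Rightarrow> ('n3 \<Rightarrow> real^'n1^'n2) \<Rightarrow> real^'n3^'n2^'n1 \<Rightarrow> real^'n3^'n2^'n1" where
  "schur_chart E G Y = of_slices (\<lambda>k. schur (E k) (G k) (frontal_slice Y k))"

definition unschur_chart ::
  "('n3::finite \<Rightarrow> real^'n2^'n1) \<Rightarrow> ('n3 \<Rightarrow> real^'n1^'n2) \<Rightarrow> real^'n3^'n2^'n1 \<Rightarrow> real^'n3^'n2^'n1" where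
  "unschur_chart E G Y = of_slices (\<lambda>k. unschur (E k) (G k) (frontal_slice Y k))"

text \<open>The set is a finite intersection, over the slices, of preimages of the nonzero reals
  under a continuous determinant.\<close>

lemma open_core_domain: "open (core_domain E G)"
proof -
  have "continuous_on UNIV (\<lambda>Y. det (core (E k) (G k) (frontal_slice Y k)))" for k
    unfolding core_def
    by (intro smooth_on_imp_continuous_on smooth_on_det smooth_on_add smooth_on_matrix_mult
        smooth_on_const smooth_on_linear[OF linear_frontal_slice] open_UNIV)
  then have "open {Y. det (core (E k) (G k) (frontal_slice Y k)) \<noteq> 0}" for k
    by (intro open_Collect_neq continuous_on_const)
  then have "open (\<Inter>k. {Y. det (core (E k) (G k) (frontal_slice Y k)) \<noteq> 0})"
    by (intro open_INT) auto
  moreover have "(\<Inter>k. {Y. det (core (E k) (G k) (frontal_slice Y k)) \<noteq> 0}) = core_domain E G"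
    by (auto simp: core_domain_def invertible_det_nz)
  ultimately show ?thesis by simp
qed

text \<open>Both maps preserve the core of every slice, hence map \<open>core_domain E G\<close> to
  itself, and they are inverse to each other slice by slice.\<close>

lemma diffeomorphism_schur_chart:
  assumes "\<And>k. generalized_inverse (E k) (G k)"
  shows "diffeomorphism (core_domain E G) (core_domain E G) (schur_chart E G) (unschur_chart E G)"
proof -
  have smooth: "smooth_on (schur_chart E G) (core_domain E G)" "smooth_on (unschur_chart E G) (core_domain E G)"
    unfolding schur_chart_def unschur_chart_def
    by (intro smooth_on_of_slices smooth_on_schur smooth_on_unschur smooth_on_linear[OF linear_frontal_slice]
        open_core_domain; simp add: core_domain_def)+
  have "homeomorphism (core_domain E G) (core_domain E G) (schur_chart E G) (unschur_chart E G)"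
    using smooth generalized_inverse.core_schur[OF assms] generalized_inverse.core_unschur[OF assms]
      generalized_inverse.unschur_schur[OF assms] generalized_inverse.schur_unschur[OF assms]
    by (intro homeomorphismI smooth_on_imp_continuous_on)
      (auto simp: core_domain_def schur_chart_def unschur_chart_def)
  then show ?thesis
    using smooth by (simp add: diffeomorphism_def open_core_domain)
qed

text \<open>Smoothness of the composite with \<open>L\<close> inside is a hypothesis, to be checked
  directly for the Schur chart; in the other direction the linear map is outermost, so
  \<open>smooth_on_linear_compose\<close> applies.\<close>

lemma diffeomorphism_linear_pullback:
  assumes "diffeomorphism U V \<phi> \<psi>" "linear L" "linear L'"
    and inv: "\<And>x. L' (L x) = x" "\<And>x. L (L' x) = x"
    and smooth: "smooth_on (\<lambda>x. \<phi> (L x)) (L -` U)"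
  shows "diffeomorphism (L -` U) V (\<lambda>x. \<phi> (L x)) (\<lambda>y. L' (\<psi> y))"
proof -
  have open_UV: "open U" "open V" and hom: "homeomorphism U V \<phi> \<psi>" and "smooth_on \<psi> V"
    using assms(1) by (auto simp: diffeomorphism_def)
  have smooth': "smooth_on (\<lambda>y. L' (\<psi> y)) V"
    using smooth_on_linear_compose \<open>linear L'\<close> \<open>open V\<close> \<open>smooth_on \<psi> V\<close> by blast
  have "open (L -` U)"
    using linear_continuous_on[of L UNIV] \<open>linear L\<close> \<open>open U\<close>
    by (auto simp: linear_conv_bounded_linear intro: open_vimage)
  moreover have "homeomorphism (L -` U) V (\<lambda>x. \<phi> (L x)) (\<lambda>y. L' (\<psi> y))"
    using hom smooth smooth' inv
    by (intro homeomorphismI smooth_on_imp_continuous_on) (auto simp: homeomorphism_def)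
  ultimately show ?thesis
    using smooth smooth' \<open>open V\<close> by (simp add: diffeomorphism_def)
qed

text \<open>This turns "the points of the manifold are those that the chart sends into S" into the
  image condition of \<open>embedded_submanifold\<close>.\<close>

lemma image_Collect_mem: "f ` {x \<in> U. f x \<in> S} = f ` U \<inter> S"
  by auto

theorem proposition2p2:
  fixes r :: "nat ^ ('n3::{finite,linorder})"
  assumes "\<And>i. r $ i \<le> min CARD('n1::finite) CARD('n2::finite)"
  shows "embedded_submanifold
           (\<Sum>i\<in>UNIV. (CARD('n1) + CARD('n2)) * (r $ i) - (r $ i)\<^sup>2)
           (fixed_multirank_set r :: (real ^ ('n3::{finite,linorder}) ^ 'n2 ^ 'n1) set)"
proof -
  let ?M = "fixed_multirank_set r :: (real ^ ('n3::{finite,linorder}) ^ 'n2 ^ 'n1) set"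
  \<comment> \<open>The bound on \<open>r\<close> provides the normal forms. Row and column indices
    have unrelated types, so an injection takes the place of a leading identity block. The choice
    does not depend on a tensor, so one subspace \<open>S\<close> serves all points.\<close>
  have "\<exists>J \<sigma>. card (J :: 'n2 set) = r $ k \<and> inj_on (\<sigma> :: 'n2 \<Rightarrow> 'n1) J" for k
  proof -
    have r: "r $ k \<le> CARD('n2)" "r $ k \<le> CARD('n1)"
      using assms[of k] by auto
    obtain J :: "'n2 set" where J: "card J = r $ k"
      using obtain_subset_with_card_n[OF r(1)] by blast
    then obtain \<sigma> :: "'n2 \<Rightarrow> 'n1" where "inj_on \<sigma> J"
      using card_le_inj[of J "UNIV :: 'n1 set"] r by auto
    then show ?thesis using J by blast
  qed
  then obtain J :: "'n3 \<Rightarrow> 'n2 set" and \<sigma> :: "'n3 \<Rightarrow> 'n2 \<Rightarrow> 'n1"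
    where cardJ: "\<And>k. card (J k) = r $ k" and inj: "\<And>k. inj_on (\<sigma> k) (J k)"
    by metis
  define E :: "'n3 \<Rightarrow> real^'n2^'n1" where "E k = partial_perm (J k) (\<sigma> k)" for k
  define G where "G k = transpose (E k)" for k
  have gi: "generalized_inverse (E k) (G k)" for k
    unfolding E_def G_def by (rule generalized_inverse_partial_perm[OF inj])
  have rankE: "rank (E k) = r $ k" for k
    unfolding E_def by (simp add: rank_partial_perm[OF inj] cardJ)
  have mem_M: "X \<in> ?M \<longleftrightarrow> (\<forall>k. rank (frontal_slice (dct_tensor X) k) = rank (E k))" for X
    by (simp add: fixed_multirank_set_def transformed_multirank_def vec_eq_iff rankE)
  define S where "S = {Y :: real^'n3::{finite,linorder}^'n2^'n1. \<forall>i j k.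
      (i, j, k) \<notin> {(i, j, k). i \<in> \<sigma> k ` J k \<or> j \<in> J k} \<longrightarrow> Y $ i $ j $ k = 0}"
  have "subspace S"
    by (auto simp: S_def subspace_def)
  have dimS: "dim S = (\<Sum>i\<in>UNIV. (CARD('n1) + CARD('n2)) * (r $ i) - (r $ i)\<^sup>2)"
    unfolding S_def dim_coordinate_tensors
    by (rule card_cross_slices) (simp_all add: card_image inj cardJ)
  have mem_S: "Y \<in> S \<longleftrightarrow> (\<forall>k. corner (E k) (G k) (frontal_slice Y k) = 0)" for Y
    by (auto simp: S_def E_def G_def vec_eq_iff corner_partial_perm[OF inj] frontal_slice_def)
  let ?V = "core_domain E G"
  let ?\<phi> = "schur_chart E G"
  let ?\<psi> = "unschur_chart E G"
  have diffeo: "diffeomorphism ?V ?V ?\<phi> ?\<psi>"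
    by (rule diffeomorphism_schur_chart[OF gi])
  have chart_mem_S: "?\<phi> Y \<in> S \<longleftrightarrow> (\<forall>k. rank (frontal_slice Y k) = rank (E k))" if "Y \<in> ?V" for Y
    using that generalized_inverse.rank_eq_iff_corner_schur[OF gi]
    by (auto simp: mem_S core_domain_def schur_chart_def)
  have "?M \<noteq> {}"
  proof -
    \<comment> \<open>With identity multipliers \<open>L\<close> is the transform itself, so
      \<open>L'\<close> recovers a tensor whose transformed slices are the matrices
      \<open>E k\<close>.\<close>
    obtain L L' :: "real^'n3::{finite,linorder}^'n2^'n1 \<Rightarrow> real^'n3::{finite,linorder}^'n2^'n1"
      where "\<And>X. L (L' X) = X"
        "\<And>X k. frontal_slice (L X) k = mat 1 ** frontal_slice (dct_tensor X) k ** mat 1"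
      using dct_slices_isomorphism[of "\<lambda>_. mat 1" "\<lambda>_. mat 1"] invertible_mat_1 by metis
    then have "frontal_slice (dct_tensor (L' (of_slices E))) k = E k" for k
      by (metis frontal_slice_of_slices matrix_mul_lid matrix_mul_rid)
    then have "L' (of_slices E) \<in> ?M"
      by (simp only: mem_M) simp
    then show ?thesis by blast
  qed
  moreover have "\<exists>U V \<phi> \<psi> (S :: (real^'n3::{finite,linorder}^'n2^'n1) set).
      X \<in> U \<and> diffeomorphism U V \<phi> \<psi> \<and> subspace S \<and>
      dim S = (\<Sum>i\<in>UNIV. (CARD('n1) + CARD('n2)) * (r $ i) - (r $ i)\<^sup>2) \<and> \<phi> ` (U \<inter> ?M) = V \<inter> S"
    if X: "X \<in> ?M" for X
  proof -
    have "\<exists>P Q. invertible P \<and> invertible Q \<and> P ** frontal_slice (dct_tensor X) k ** Q = E k" for k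
    proof -
      have "rank (frontal_slice (dct_tensor X) k) = card (J k)"
        using X by (simp add: mem_M rankE cardJ)
      then show ?thesis
        using rank_normal_form[OF inj] unfolding E_def by metis
    qed
    \<comment> \<open>These multipliers depend on the point \<open>X\<close>; they make
      \<open>L\<close> below send \<open>X\<close> to the tensor with slices
      \<open>E k\<close>.\<close>
    then obtain P Q where PQ: "\<And>k. invertible (P k)" "\<And>k. invertible (Q k)"
        "\<And>k. P k ** frontal_slice (dct_tensor X) k ** Q k = E k"
      by metis
    obtain L L' :: "real^'n3::{finite,linorder}^'n2^'n1 \<Rightarrow> real^'n3::{finite,linorder}^'n2^'n1"
      where L: "linear L" "linear L'" "\<And>X. L' (L X) = X" "\<And>X. L (L' X) = X"
        and slice: "\<And>X k. frontal_slice (L X) k = P k ** frontal_slice (dct_tensor X) k ** Q k"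
      using dct_slices_isomorphism[of P Q] PQ(1,2) by metis
    have open_U: "open (L -` ?V)"
      using linear_continuous_on[of L UNIV] \<open>linear L\<close> open_core_domain
      by (auto simp: linear_conv_bounded_linear intro: open_vimage)
    have "smooth_on (\<lambda>x. ?\<phi> (L x)) (L -` ?V)"
      unfolding schur_chart_def
      by (intro smooth_on_of_slices smooth_on_schur open_U
          smooth_on_linear_compose[OF linear_frontal_slice] smooth_on_linear \<open>linear L\<close>)
        (auto simp: core_domain_def)
    then have diffeo': "diffeomorphism (L -` ?V) ?V (\<lambda>x. ?\<phi> (L x)) (\<lambda>y. L' (?\<psi> y))"
      by (intro diffeomorphism_linear_pullback[OF diffeo] L)
    \<comment> \<open>Invertible multipliers preserve rank, so membership can be read off in the new
      coordinates for every tensor, not only at \<open>X\<close>.\<close>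
    have mem_M': "Z \<in> ?M \<longleftrightarrow> (\<forall>k. rank (frontal_slice (L Z) k) = rank (E k))" for Z
      by (simp add: mem_M slice rank_invertible_mult[OF PQ(1,2)])
    have "(\<lambda>x. ?\<phi> (L x)) ` (L -` ?V) = ?V"
      using diffeo' by (simp add: diffeomorphism_def homeomorphism_def)
    moreover have "L -` ?V \<inter> ?M = {Z \<in> L -` ?V. ?\<phi> (L Z) \<in> S}"
      using chart_mem_S mem_M' by (simp add: set_eq_iff) metis
    ultimately have "(\<lambda>x. ?\<phi> (L x)) ` (L -` ?V \<inter> ?M) = ?V \<inter> S"
      by (simp only: image_Collect_mem)
    \<comment> \<open>The slices of \<open>L X\<close> are the \<open>E k\<close>, whose cores are
      the identity matrix.\<close>
    moreover have "X \<in> L -` ?V"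
      by (simp add: core_domain_def slice PQ(3) generalized_inverse.core_self[OF gi] invertible_mat_1)
    ultimately show ?thesis
      using diffeo' \<open>subspace S\<close> dimS by (intro exI conjI)
  qed
  ultimately show ?thesis
    unfolding embedded_submanifold_def by (intro conjI ballI)
qed

end
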